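(* Let $G$ be a residually finite group. If $\alpha:G\to G$ is an inner automorphism, then $\operatorname{Alex}(G,\alpha)$ is a residually finite quandle.
   Context: A quandle is a non-empty set $X$ with a binary operation $*$ such that: (1) $x*x=x$ for all $x\in X$; (2) for all $x,y\in X$ there is a unique $z\in X$ with $x=z*y$; (3) $(x*y)*z=(x*z)*(y*z)$ for all $x,y,z\in X$. A quandle homomorphism is a map $f$ with $f(x*y)=f(x)*f(y)$. A quandle $X$ is residually finite if for all $x,y\in X$ with $x\neq y$ there exist a finite quandle $F$ and a quandle homomorphism $\phi:X\to F$ with $\phi(x)\neq\phi(y)$. For a group $G$ and a group automorphism $\varphi$ of $G$, the generalized Alexander quandle $\operatorname{Alex}(G,\varphi)$ is the set $G$ with the quandle operation $a*b=\varphi(ab^{-1})b$. A group $G$ is residually finite if for each $g\in G$, $g\ne1$, there are a finite group $F$ and a group homomorphism $\phi:G\to F$ with $\phi(g)\neq 1$. *)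

theory Defs
  imports "HOL-Algebra.Group"
begin

section \<open>Quandles\<close>

record 'a quandle = "'a partial_object" +
  qop :: "['a, 'a] \<Rightarrow> 'a" (infixl \<open>\<star>\<index>\<close> 70)

locale quandle =
  fixes X (structure)
  assumes nonempty: "carrier X \<noteq> {}"
    and closed: "\<lbrakk>x \<in> carrier X; y \<in> carrier X\<rbrakk> \<Longrightarrow> x \<star> y \<in> carrier X"
    and idem: "x \<in> carrier X \<Longrightarrow> x \<star> x = x"
    and right_divisible:
      "\<lbrakk>x \<in> carrier X; y \<in> carrier X\<rbrakk> \<Longrightarrow> \<exists>!z. z \<in> carrier X \<and> x = z \<star> y"
    and right_distrib:
      "\<lbrakk>x \<in> carrier X; y \<in> carrier X; z \<in> carrier X\<rbrakk>
        \<Longrightarrow> (x \<star> y) \<star> z = (x \<star> z) \<star> (y \<star> z)"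

definition quandle_hom :: "('a, 'm) quandle_scheme \<Rightarrow> ('b, 'n) quandle_scheme \<Rightarrow> ('a \<Rightarrow> 'b) set"
  where "quandle_hom X Y =
    {f. f \<in> carrier X \<rightarrow> carrier Y \<and>
      (\<forall>x \<in> carrier X. \<forall>y \<in> carrier X. f (x \<star>\<^bsub>X\<^esub> y) = f x \<star>\<^bsub>Y\<^esub> f y)}"

section \<open>Residual finiteness\<close>

text \<open>
  HOL cannot quantify existentially over types, so the finite targets are taken with carrier a
  finite set of natural numbers. Every finite structure is isomorphic to one of these; the lemmas
  \<open>finite_quandle_separates\<close> and \<open>finite_group_separates\<close> below show that a separating homomorphism
  into a finite structure over any type yields one of the required form.
\<close>

definition residually_finite_quandle :: "('a, 'm) quandle_scheme \<Rightarrow> bool"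
  where "residually_finite_quandle X \<longleftrightarrow> quandle X \<and>
    (\<forall>x \<in> carrier X. \<forall>y \<in> carrier X. x \<noteq> y \<longrightarrow>
      (\<exists>(F :: nat quandle) \<phi>. quandle F \<and> finite (carrier F) \<and>
        \<phi> \<in> quandle_hom X F \<and> \<phi> x \<noteq> \<phi> y))"

definition residually_finite_group :: "('a, 'm) monoid_scheme \<Rightarrow> bool"
  where "residually_finite_group G \<longleftrightarrow> group G \<and>
    (\<forall>g \<in> carrier G. g \<noteq> \<one>\<^bsub>G\<^esub> \<longrightarrow>
      (\<exists>(F :: nat monoid) \<phi>. group F \<and> finite (carrier F) \<and>
        \<phi> \<in> hom G F \<and> \<phi> g \<noteq> \<one>\<^bsub>F\<^esub>))"

lemma finite_quandle_separates:
  fixes F :: "('c, 'n) quandle_scheme"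
  assumes F: "quandle F" "finite (carrier F)"
    and \<phi>: "\<phi> \<in> quandle_hom X F" "x \<in> carrier X" "y \<in> carrier X" "\<phi> x \<noteq> \<phi> y"
  shows "\<exists>(F' :: nat quandle) \<phi>'. quandle F' \<and> finite (carrier F') \<and>
           \<phi>' \<in> quandle_hom X F' \<and> \<phi>' x \<noteq> \<phi>' y"
proof -
  interpret quandle F by (rule F(1))
  obtain h :: "'c \<Rightarrow> nat" where h: "inj_on h (carrier F)"
    using F(2) finite_imp_inj_to_nat_seg by blast
  define k where "k = inv_into (carrier F) h"
  have k [simp]: "k (h a) = a" if "a \<in> carrier F" for a
    using h that by (simp add: k_def)
  define F' :: "nat quandle"
    where "F' = \<lparr>carrier = h ` carrier F, qop = (\<lambda>a b. h (k a \<star>\<^bsub>F\<^esub> k b))\<rparr>"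
  have inj: "h a = h b \<longleftrightarrow> a = b" if "a \<in> carrier F" "b \<in> carrier F" for a b
    using h that by (auto dest: inj_onD)
  have "quandle F'"
  proof
    fix a b assume "a \<in> carrier F'" "b \<in> carrier F'"
    then obtain u v where uv: "u \<in> carrier F" "v \<in> carrier F" "a = h u" "b = h v"
      by (auto simp: F'_def)
    obtain z where z: "z \<in> carrier F" "u = z \<star>\<^bsub>F\<^esub> v"
      and uniq: "\<And>w. w \<in> carrier F \<Longrightarrow> u = w \<star>\<^bsub>F\<^esub> v \<Longrightarrow> w = z"
      using right_divisible[OF uv(1,2)] by blast
    show "\<exists>!z. z \<in> carrier F' \<and> a = z \<star>\<^bsub>F'\<^esub> b"
    proof (rule ex1I[of _ "h z"])
      show "h z \<in> carrier F' \<and> a = h z \<star>\<^bsub>F'\<^esub> b"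
        using uv z by (auto simp: F'_def)
      show "c = h z" if "c \<in> carrier F' \<and> a = c \<star>\<^bsub>F'\<^esub> b" for c
        using that uv uniq by (auto simp: F'_def inj closed)
    qed
  qed (use nonempty in \<open>auto simp: F'_def closed idem right_distrib [symmetric]\<close>)
  moreover have "h \<circ> \<phi> \<in> quandle_hom X F'"
    using \<phi>(1) by (auto simp: quandle_hom_def F'_def Pi_iff)
  moreover have "(h \<circ> \<phi>) x \<noteq> (h \<circ> \<phi>) y"
    using \<phi> by (auto simp: quandle_hom_def inj Pi_iff)
  ultimately show ?thesis
    using F(2) by (intro exI[of _ F'] exI[of _ "h \<circ> \<phi>"]) (auto simp: F'_def)
qed

lemma finite_group_separates:
  fixes F :: "('c, 'n) monoid_scheme"
  assumes F: "group F" "finite (carrier F)"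
    and \<phi>: "\<phi> \<in> hom G F" "g \<in> carrier G" "\<phi> g \<noteq> \<one>\<^bsub>F\<^esub>"
  shows "\<exists>(F' :: nat monoid) \<phi>'. group F' \<and> finite (carrier F') \<and>
           \<phi>' \<in> hom G F' \<and> \<phi>' g \<noteq> \<one>\<^bsub>F'\<^esub>"
proof -
  interpret group F by (rule F(1))
  obtain h :: "'c \<Rightarrow> nat" where h: "inj_on h (carrier F)"
    using F(2) finite_imp_inj_to_nat_seg by blast
  define k where "k = inv_into (carrier F) h"
  have k [simp]: "k (h a) = a" if "a \<in> carrier F" for a
    using h that by (simp add: k_def)
  define F' :: "nat monoid"
    where "F' = \<lparr>carrier = h ` carrier F, mult = (\<lambda>a b. h (k a \<otimes>\<^bsub>F\<^esub> k b)), one = h \<one>\<^bsub>F\<^esub>\<rparr>"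
  have inj: "h a = h b \<longleftrightarrow> a = b" if "a \<in> carrier F" "b \<in> carrier F" for a b
    using h that by (auto dest: inj_onD)
  have "group F'"
    by (rule groupI) (auto simp: F'_def m_assoc inj intro!: bexI[of _ "inv\<^bsub>F\<^esub> _"])
  moreover have "h \<circ> \<phi> \<in> hom G F'"
    using \<phi>(1) by (auto simp: hom_def F'_def Pi_iff)
  moreover have "(h \<circ> \<phi>) g \<noteq> \<one>\<^bsub>F'\<^esub>"
    using \<phi> by (auto simp: hom_def F'_def inj Pi_iff)
  ultimately show ?thesis
    using F(2) by (intro exI[of _ F'] exI[of _ "h \<circ> \<phi>"]) (auto simp: F'_def)
qed

section \<open>Generalized Alexander quandles\<close>

definition Alex :: "('a, 'm) monoid_scheme \<Rightarrow> ('a \<Rightarrow> 'a) \<Rightarrow> 'a quandle"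
  where "Alex G \<phi> =
    \<lparr>carrier = carrier G, qop = (\<lambda>a b. \<phi> (a \<otimes>\<^bsub>G\<^esub> inv\<^bsub>G\<^esub> b) \<otimes>\<^bsub>G\<^esub> b)\<rparr>"

text \<open>
  Only the values on the carrier matter, so no extensionality is imposed outside of it (unlike
  for elements of \<open>auto G\<close>).
\<close>

definition inner_automorphism :: "('a, 'm) monoid_scheme \<Rightarrow> ('a \<Rightarrow> 'a) \<Rightarrow> bool"
  where "inner_automorphism G \<alpha> \<longleftrightarrow>
    (\<exists>g \<in> carrier G. \<forall>x \<in> carrier G. \<alpha> x = g \<otimes>\<^bsub>G\<^esub> x \<otimes>\<^bsub>G\<^esub> inv\<^bsub>G\<^esub> g)"

lemma (in group) inner_automorphism_iso:
  assumes "inner_automorphism G \<alpha>"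
  shows "\<alpha> \<in> iso G G"
proof -
  obtain g where g: "g \<in> carrier G" "\<And>x. x \<in> carrier G \<Longrightarrow> \<alpha> x = g \<otimes> x \<otimes> inv g"
    using assms by (auto simp: inner_automorphism_def)
  have cancel: "inv g \<otimes> (g \<otimes> x) = x" "g \<otimes> (inv g \<otimes> x) = x" if "x \<in> carrier G" for x
    using g(1) that by (simp_all add: m_assoc [symmetric])
  have "\<alpha> \<in> hom G G"
    using g by (auto simp: hom_def m_assoc cancel)
  moreover have "bij_betw \<alpha> (carrier G) (carrier G)"
    by (rule bij_betwI [where g = "\<lambda>x. inv g \<otimes> x \<otimes> g"]) (use g in \<open>auto simp: m_assoc cancel\<close>)
  ultimately show ?thesis by (rule isoI)
qed

end

theory Submission
  imports Defs
begin

text \<open>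
  If \<open>\<alpha>\<close> is conjugation by \<open>g\<close>, then every group homomorphism \<open>\<phi> : G \<rightarrow> F\<close> is also a quandle
  homomorphism from \<open>Alex G \<alpha>\<close> to \<open>Alex F \<beta>\<close> with \<open>\<beta>\<close> conjugation by \<open>\<phi> g\<close>, because
  \<open>\<phi> \<circ> \<alpha> = \<beta> \<circ> \<phi>\<close>. To separate \<open>x \<noteq> y\<close> it therefore suffices that \<open>\<phi>\<close> does not kill \<open>x y\<^sup>-\<^sup>1\<close>.
\<close>

lemma carrier_Alex [simp]: "carrier (Alex G \<phi>) = carrier G"
  by (simp add: Alex_def)

lemma qop_Alex [simp]: "a \<star>\<^bsub>Alex G \<phi>\<^esub> b = \<phi> (a \<otimes>\<^bsub>G\<^esub> inv\<^bsub>G\<^esub> b) \<otimes>\<^bsub>G\<^esub> b"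
  by (simp add: Alex_def)

text \<open>Dividing by \<open>y\<close> on the right means solving
  \<open>\<alpha> (z \<otimes> inv y) = x \<otimes> inv y\<close> for \<open>z\<close>: surjectivity
  of \<open>\<alpha>\<close> gives existence and injectivity gives uniqueness.\<close>

lemma (in group) quandle_Alex:
  assumes "\<alpha> \<in> iso G G"
  shows "quandle (Alex G \<alpha>)"
proof -
  have hom: "\<alpha> \<in> hom G G" and bij: "bij_betw \<alpha> (carrier G) (carrier G)"
    using assms by (auto simp: iso_def)
  interpret \<alpha>: group_hom G G \<alpha>
    using hom by unfold_locales
  show ?thesis
  proof
    fix x y assume xy: "x \<in> carrier (Alex G \<alpha>)" "y \<in> carrier (Alex G \<alpha>)"
    have "x \<otimes> inv y \<in> \<alpha> ` carrier G"
      using xy bij by (simp add: bij_betw_imp_surj_on)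
    then obtain w where w: "w \<in> carrier G" "\<alpha> w = x \<otimes> inv y"
      by force
    show "\<exists>!z. z \<in> carrier (Alex G \<alpha>) \<and> x = z \<star>\<^bsub>Alex G \<alpha>\<^esub> y"
    proof (rule ex1I[of _ "w \<otimes> y"])
      show "w \<otimes> y \<in> carrier (Alex G \<alpha>) \<and> x = (w \<otimes> y) \<star>\<^bsub>Alex G \<alpha>\<^esub> y"
        using xy w by (simp add: m_assoc del: \<alpha>.hom_mult)
    next
      fix z assume z: "z \<in> carrier (Alex G \<alpha>) \<and> x = z \<star>\<^bsub>Alex G \<alpha>\<^esub> y"
      then have "\<alpha> (z \<otimes> inv y) = \<alpha> w"
        using xy w by (simp add: m_assoc)
      then have "z \<otimes> inv y = w"
        by (rule inj_onD[OF bij_betw_imp_inj_on[OF bij]]) (use xy z w in auto)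
      then show "z = w \<otimes> y"
        using xy z by (auto simp: m_assoc)
    qed
  next
    fix x y z
    assume "x \<in> carrier (Alex G \<alpha>)" "y \<in> carrier (Alex G \<alpha>)" "z \<in> carrier (Alex G \<alpha>)"
    then show "(x \<star>\<^bsub>Alex G \<alpha>\<^esub> y) \<star>\<^bsub>Alex G \<alpha>\<^esub> z
        = (x \<star>\<^bsub>Alex G \<alpha>\<^esub> z) \<star>\<^bsub>Alex G \<alpha>\<^esub> (y \<star>\<^bsub>Alex G \<alpha>\<^esub> z)"
      \<comment> \<open>The trailing \<open>z\<close> cancels between the two factors on the right,
        so both sides equal \<open>\<alpha> (\<alpha> (x \<otimes> inv y)) \<otimes> \<alpha> (y
        \<otimes> inv z) \<otimes> z\<close>.\<close>
      by (simp add: m_assoc inv_mult_group inv_solve_left' flip: \<alpha>.hom_inv)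
        (simp add: inv_mult_group flip: m_assoc)
  qed auto
qed

lemma hom_imp_quandle_hom_Alex:
  assumes "group G" "group F" "\<phi> \<in> hom G F"
    and \<alpha>: "\<alpha> \<in> carrier G \<rightarrow> carrier G"
    and comm: "\<And>x. x \<in> carrier G \<Longrightarrow> \<phi> (\<alpha> x) = \<beta> (\<phi> x)"
  shows "\<phi> \<in> quandle_hom (Alex G \<alpha>) (Alex F \<beta>)"
proof -
  interpret group_hom G F \<phi>
    using assms by (simp add: group_hom_def group_hom_axioms_def)
  have "\<phi> (\<alpha> (x \<otimes>\<^bsub>G\<^esub> inv\<^bsub>G\<^esub> y) \<otimes>\<^bsub>G\<^esub> y) = \<beta> (\<phi> x \<otimes>\<^bsub>F\<^esub> inv\<^bsub>F\<^esub> \<phi> y) \<otimes>\<^bsub>F\<^esub> \<phi> y"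
    if "x \<in> carrier G" "y \<in> carrier G" for x y
    \<comment> \<open>Splitting the image under \<open>\<phi>\<close> of the outer product needs its
      left factor, a value of \<open>\<alpha>\<close>, to lie in the carrier; \<open>comm\<close>
      then moves \<open>\<phi>\<close> past \<open>\<alpha>\<close>.\<close>
    using that funcset_mem[OF \<alpha>, of "x \<otimes>\<^bsub>G\<^esub> inv\<^bsub>G\<^esub> y"] by (simp add: comm)
  then show ?thesis
    by (auto simp: quandle_hom_def)
qed

theorem proposition4p2:
  fixes G :: "('a, 'm) monoid_scheme" and \<alpha> :: "'a \<Rightarrow> 'a"
  assumes "residually_finite_group G"
    and "inner_automorphism G \<alpha>"
  shows "residually_finite_quandle (Alex G \<alpha>)"
proof -
  interpret group G
    using assms(1) by (simp add: residually_finite_group_def)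
  obtain g where g: "g \<in> carrier G" "\<And>x. x \<in> carrier G \<Longrightarrow> \<alpha> x = g \<otimes>\<^bsub>G\<^esub> x \<otimes>\<^bsub>G\<^esub> inv\<^bsub>G\<^esub> g"
    using assms(2) by (auto simp: inner_automorphism_def)
  have \<alpha>: "\<alpha> \<in> iso G G"
    using assms(2) by (rule inner_automorphism_iso)
  show ?thesis
    unfolding residually_finite_quandle_def
  proof (intro conjI ballI impI)
    show "quandle (Alex G \<alpha>)"
      using \<alpha> by (rule quandle_Alex)
  next
    fix x y assume "x \<in> carrier (Alex G \<alpha>)" "y \<in> carrier (Alex G \<alpha>)" and "x \<noteq> y"
    then have xy: "x \<in> carrier G" "y \<in> carrier G" "x \<otimes>\<^bsub>G\<^esub> inv\<^bsub>G\<^esub> y \<noteq> \<one>\<^bsub>G\<^esub>"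
      \<comment> \<open>If the product were trivial, \<open>x\<close> would be the inverse of
        \<open>inv y\<close>, that is, \<open>y\<close>.\<close>
      using inv_equality by fastforce+
    then obtain F :: "nat monoid" and \<phi> where F: "group F" "finite (carrier F)"
      and \<phi>: "\<phi> \<in> hom G F" "\<phi> (x \<otimes>\<^bsub>G\<^esub> inv\<^bsub>G\<^esub> y) \<noteq> \<one>\<^bsub>F\<^esub>"
      using assms(1) unfolding residually_finite_group_def by (meson inv_closed m_closed)
    interpret \<phi>: group_hom G F \<phi>
      using F \<phi> by (simp add: group_hom_def group_hom_axioms_def is_group)
    define \<beta> where "\<beta> u = \<phi> g \<otimes>\<^bsub>F\<^esub> u \<otimes>\<^bsub>F\<^esub> inv\<^bsub>F\<^esub> \<phi> g" for u
    have "inner_automorphism F \<beta>"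
      using g(1) by (auto simp: inner_automorphism_def \<beta>_def)
    then have "quandle (Alex F \<beta>)"
      by (intro \<phi>.H.quandle_Alex \<phi>.H.inner_automorphism_iso)
    moreover have "\<phi> \<in> quandle_hom (Alex G \<alpha>) (Alex F \<beta>)"
      using g \<alpha> by (intro hom_imp_quandle_hom_Alex)
        (auto simp: \<beta>_def F \<phi> is_group iso_def hom_def)
    moreover have "\<phi> x \<noteq> \<phi> y"
      using \<phi>(2) xy by auto
    ultimately show "\<exists>(F :: nat quandle) \<phi>. quandle F \<and> finite (carrier F) \<and>
        \<phi> \<in> quandle_hom (Alex G \<alpha>) F \<and> \<phi> x \<noteq> \<phi> y"
      using F(2) by (intro exI[of _ "Alex F \<beta>"] exI[of _ \<phi>]) simp
  qed
qed

end
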